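(* There exists an absolute constant $C>0$ such that the following holds. Let $k\ge 2$, $n\ge 2$ be integers and $\varepsilon\ge 1$. Let $x_1,\dots,x_n\in[k]$ be an arbitrary dataset with empirical frequency vector $q\in\mathbb{R}^k$, $q_j=\frac1n\sum_{i=1}^n\mathbf{1}\{x_i=j\}$. Run the (simplified) RAPPOR protocol: each user $i$ forms the one-hot vector $e_{x_i}\in\{0,1\}^k$ and flips each of its $k$ bits independently (and independently across users) with probability $\frac{1}{e^{\varepsilon/2}+1}$, producing $Y_i\in\{0,1\}^k$; the server computes $\bar Y=\frac1n\sum_{i=1}^n Y_i$ and outputs $\hat q=\frac{e^{\varepsilon/2}+1}{e^{\varepsilon/2}-1}\bar Y-\frac{1}{e^{\varepsilon/2}-1}\mathbf{1}_k$. Then $$\mathbb{E}\big[\|\hat q-q\|_\infty\big]\le C\left(\sqrt{\frac{\log k}{n\,e^{\varepsilon/2}}}+\frac{\log k}{n\,\varepsilon}\log n\right).$$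
   Context: $\mathbf 1_k$ is the all-ones vector of length $k$; the expectation is over the randomness of the bit flips; $\log$ is the natural logarithm. *)

theory Defs
  imports "HOL-Probability.Probability"
begin

text \<open>
  Vectors indexed by \<open>[k] = {1..k}\<close> are functions \<open>nat \<Rightarrow> real\<close>, and bit strings in
  \<open>{0,1}^k\<close> are functions \<open>nat \<Rightarrow> bool\<close>; only the values on \<open>{1..k}\<close> matter.
  Datasets \<open>x\<close> and families of reports \<open>Y\<close> are indexed by the users \<open>{1..n}\<close>.
\<close>

definition sup_norm :: "nat \<Rightarrow> (nat \<Rightarrow> real) \<Rightarrow> real" where
  "sup_norm k v = Max ((\<lambda>j. \<bar>v j\<bar>) ` {1..k})"

definition emp_freq :: "nat \<Rightarrow> (nat \<Rightarrow> nat) \<Rightarrow> nat \<Rightarrow> real" where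
  "emp_freq n x j = (1 / real n) * (\<Sum>i\<in>{1..n}. of_bool (x i = j))"

definition one_hot :: "nat \<Rightarrow> nat \<Rightarrow> bool" where
  "one_hot a j \<longleftrightarrow> j = a"

definition flip_prob :: "real \<Rightarrow> real" where
  "flip_prob \<epsilon> = 1 / (exp (\<epsilon> / 2) + 1)"

text \<open>The report of one user with value \<open>a\<close>: bit \<open>j\<close> is the exclusive or of the one-hot bit
  with an independent flip indicator. Bits outside \<open>{1..k}\<close> are fixed to \<open>False\<close>.\<close>

definition rappor_report :: "nat \<Rightarrow> real \<Rightarrow> nat \<Rightarrow> (nat \<Rightarrow> bool) pmf" where
  "rappor_report k \<epsilon> a =
     Pi_pmf {1..k} False
       (\<lambda>j. map_pmf (\<lambda>flipped. one_hot a j \<noteq> flipped) (bernoulli_pmf (flip_prob \<epsilon>)))"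

definition rappor_reports ::
  "nat \<Rightarrow> nat \<Rightarrow> real \<Rightarrow> (nat \<Rightarrow> nat) \<Rightarrow> (nat \<Rightarrow> nat \<Rightarrow> bool) pmf" where
  "rappor_reports k n \<epsilon> x =
     Pi_pmf {1..n} (\<lambda>_. False) (\<lambda>i. rappor_report k \<epsilon> (x i))"

definition report_mean :: "nat \<Rightarrow> (nat \<Rightarrow> nat \<Rightarrow> bool) \<Rightarrow> nat \<Rightarrow> real" where
  "report_mean n Y j = (1 / real n) * (\<Sum>i\<in>{1..n}. of_bool (Y i j))"

definition rappor_estimate :: "nat \<Rightarrow> real \<Rightarrow> (nat \<Rightarrow> nat \<Rightarrow> bool) \<Rightarrow> nat \<Rightarrow> real" where
  "rappor_estimate n \<epsilon> Y j =
     (exp (\<epsilon> / 2) + 1) / (exp (\<epsilon> / 2) - 1) * report_mean n Y j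
       - 1 / (exp (\<epsilon> / 2) - 1)"

end

theory Submission
  imports Defs
begin

text \<open>
  The estimation error in coordinate \<open>j\<close> is a factor of at most \<open>5\<close> times the average of \<open>n\<close>
  independent variables, each of which is plus or minus a centred Bernoulli variable with
  parameter \<open>p = flip_prob \<epsilon> \<le> exp (- \<epsilon> / 2)\<close>. Bounding the moment generating functions of their
  sums as for a Poisson variable gives, for every \<open>l > 0\<close>, the bound
  \<open>(ln (2 k) + n p (exp l - 1 - l)) / l\<close> on the expected maximum of their absolute values. If
  \<open>\<epsilon> \<le> 4 ln n\<close>, then the choice \<open>l = min 1 (sqrt (ln k / (n exp (- \<epsilon> / 2))))\<close> yields a Bernstein
  bound, which suffices. Otherwise the flips are so rare that \<open>l = \<epsilon> / 4\<close> keeps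
  \<open>n p exp l \<le> 1\<close>, and this gains the factor \<open>1 / \<epsilon>\<close>.
\<close>

section \<open>Exponential moments of a centred Bernoulli variable\<close>

text \<open>The difference of the two sides is \<open>exp l - exp (-l) - 2 * l\<close>, which
  vanishes at 0 and has nonnegative derivative by the inequality of arithmetic and geometric means.
  This lets one bound serve both signs of the exponent.\<close>

lemma exp_minus_second_order_le:
  fixes l :: real
  assumes "l \<ge> 0"
  shows "exp (-l) - 1 + l \<le> exp l - 1 - l"
proof -
  have "(\<lambda>x::real. exp x - exp (-x) - 2 * x) 0 \<le> (\<lambda>x. exp x - exp (-x) - 2 * x) l"
  proof (rule DERIV_nonneg_imp_nondecreasing[OF assms])
    fix x :: real
    have "exp x + exp (-x) - 2 \<ge> 0"
      using exp_ge_add_one_self[of "x / 2"] arith_geo_mean_sqrt[of "exp x" "exp (-x)"]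
      by (simp add: exp_minus)
    moreover have "((\<lambda>x. exp x - exp (-x) - 2 * x) has_real_derivative exp x + exp (-x) - 2) (at x)"
      by (auto intro!: derivative_eq_intros)
    ultimately show "\<exists>y. ((\<lambda>x. exp x - exp (-x) - 2 * x) has_real_derivative y) (at x) \<and> 0 \<le> y"
      by blast
  qed
  then show ?thesis by simp
qed

text \<open>Applying \<open>1 + t \<le> exp t\<close> to the Bernoulli generating function yields
  that of a centred Poisson variable with mean \<open>p\<close>; a negative \<open>s\<close> is no
  worse than \<open>l\<close>.\<close>

lemma bernoulli_centered_mgf_le:
  fixes p l s :: real
  assumes p: "0 \<le> p" "p \<le> 1" and l: "l \<ge> 0" and s: "\<bar>s\<bar> = l"
  shows "measure_pmf.expectation (bernoulli_pmf p) (\<lambda>b. exp (s * (of_bool b - p)))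
           \<le> exp (p * (exp l - 1 - l))"
proof -
  have "measure_pmf.expectation (bernoulli_pmf p) (\<lambda>b. exp (s * (of_bool b - p)))
      = exp (- s * p) * (1 + p * (exp s - 1))"
    using p by (simp add: algebra_simps exp_diff exp_minus divide_simps)
  also have "\<dots> \<le> exp (- s * p) * exp (p * (exp s - 1))"
    by (intro mult_left_mono) auto
  also have "\<dots> = exp (p * (exp s - 1 - s))"
    by (simp flip: exp_add add: algebra_simps)
  also have "\<dots> \<le> exp (p * (exp l - 1 - l))"
  proof -
    have "exp s - 1 - s \<le> exp l - 1 - l"
      using exp_minus_second_order_le[OF l] s by (cases "s \<ge> 0") auto
    then show ?thesis using p by (simp add: mult_left_mono)
  qed
  finally show ?thesis .
qed

section \<open>Expected maximum from exponential moments\<close>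

text \<open>The exponential of \<open>l\<close> times the maximum is at most the sum
  \<open>S\<close> of the exponentials of all \<open>\<plusminus> l * X j\<close>, whose expectation
  is at most \<open>A = 2 * card J * B\<close>.\<close>

lemma expectation_Max_abs_le:
  fixes X :: "'j \<Rightarrow> 'a \<Rightarrow> real" and l B :: real
  assumes M: "finite (set_pmf M)" and J: "finite J" "J \<noteq> {}" and l: "l > 0" and B: "B > 0"
    and mgf: "\<And>j s. j \<in> J \<Longrightarrow> \<bar>s\<bar> = l \<Longrightarrow> measure_pmf.expectation M (\<lambda>y. exp (s * X j y)) \<le> B"
  shows "measure_pmf.expectation M (\<lambda>y. Max ((\<lambda>j. \<bar>X j y\<bar>) ` J)) \<le> ln (2 * real (card J) * B) / l"
proof -
  define A where "A = 2 * real (card J) * B"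
  define S where "S = (\<lambda>y. \<Sum>j\<in>J. exp (l * X j y) + exp (- l * X j y))"
  have A: "A > 0" using J B by (simp add: A_def card_gt_0_iff)
  have int: "integrable M f" for f :: "'a \<Rightarrow> real"
    using M by (rule integrable_measure_pmf_finite)
  \<comment> \<open>The logarithm lies below its tangent at \<open>A\<close>, so
    \<open>ln (S y) \<le> ln A - 1 + S y / A\<close>. Integrating this pointwise bound takes the
    place of Jensen's inequality.\<close>
  have point: "l * Max ((\<lambda>j. \<bar>X j y\<bar>) ` J) \<le> ln A - 1 + S y / A" for y
  proof -
    have "Max ((\<lambda>j. \<bar>X j y\<bar>) ` J) \<in> (\<lambda>j. \<bar>X j y\<bar>) ` J"
      using J by (intro Max_in) auto
    then obtain j where j: "j \<in> J" "Max ((\<lambda>j. \<bar>X j y\<bar>) ` J) = \<bar>X j y\<bar>" by auto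
    have "exp (l * \<bar>X j y\<bar>) \<le> exp (l * X j y) + exp (- l * X j y)"
      by (cases "X j y \<ge> 0") auto
    also have "\<dots> \<le> S y"
      unfolding S_def using J j(1)
      by (intro member_le_sum[of j J "\<lambda>j. exp (l * X j y) + exp (- l * X j y)"]) auto
    finally have "exp (l * \<bar>X j y\<bar>) / A \<le> S y / A" using A by (simp add: divide_right_mono)
    moreover have "1 + (l * \<bar>X j y\<bar> - ln A) \<le> exp (l * \<bar>X j y\<bar> - ln A)"
      by (rule exp_ge_add_one_self)
    moreover have "exp (l * \<bar>X j y\<bar> - ln A) = exp (l * \<bar>X j y\<bar>) / A"
      using A by (simp add: exp_diff)
    ultimately show ?thesis using j by simp
  qed
  have "measure_pmf.expectation M S
      = (\<Sum>j\<in>J. measure_pmf.expectation M (\<lambda>y. exp (l * X j y))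
               + measure_pmf.expectation M (\<lambda>y. exp (- l * X j y)))"
    unfolding S_def by (simp add: int Bochner_Integration.integral_sum Bochner_Integration.integral_add)
  also have "\<dots> \<le> (\<Sum>j\<in>J. B + B)"
    using l by (intro sum_mono add_mono mgf) auto
  finally have ES: "measure_pmf.expectation M S \<le> A" by (simp add: A_def)
  have "l * measure_pmf.expectation M (\<lambda>y. Max ((\<lambda>j. \<bar>X j y\<bar>) ` J))
      = measure_pmf.expectation M (\<lambda>y. l * Max ((\<lambda>j. \<bar>X j y\<bar>) ` J))"
    by simp
  also have "\<dots> \<le> measure_pmf.expectation M (\<lambda>y. ln A - 1 + S y / A)"
    by (intro integral_mono int point)
  also have "\<dots> = ln A - 1 + measure_pmf.expectation M S / A"
    by (simp add: int Bochner_Integration.integral_add)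
  also have "\<dots> \<le> ln A" using ES A by (simp add: field_simps)
  finally show ?thesis using l by (simp add: A_def field_simps)
qed

section \<open>Exponential moments of the RAPPOR reports\<close>

text \<open>Here \<open>h\<close> is the one-hot bit before flipping and \<open>p\<close> the flip
  probability.\<close>

definition report_bit_mean :: "real \<Rightarrow> bool \<Rightarrow> real" where
  "report_bit_mean p h = (if h then 1 - p else p)"

lemma flip_prob_bounds: "0 \<le> flip_prob \<epsilon>" "flip_prob \<epsilon> \<le> 1" "flip_prob \<epsilon> \<le> exp (- \<epsilon> / 2)"
  by (auto simp: flip_prob_def exp_minus field_simps add_pos_pos)

text \<open>Used twice, over bits and over users, to get finite support; every real function of the
  reports is then integrable.\<close>

lemma finite_set_Pi_pmf:
  assumes "finite A" "\<And>a. a \<in> A \<Longrightarrow> finite (set_pmf (p a))"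
  shows "finite (set_pmf (Pi_pmf A d p))"
  using assms by (subst set_Pi_pmf) (auto intro!: finite_PiE_dflt)

lemma finite_set_rappor_report: "finite (set_pmf (rappor_report k \<epsilon> a))"
  unfolding rappor_report_def by (intro finite_set_Pi_pmf) (auto intro: finite_subset[of _ UNIV])

lemma finite_set_rappor_reports: "finite (set_pmf (rappor_reports k n \<epsilon> x))"
  unfolding rappor_reports_def by (intro finite_set_Pi_pmf) (auto intro: finite_set_rappor_report)

lemma rappor_report_mgf_le:
  assumes j: "j \<in> {1..k}" and s: "\<bar>s\<bar> = l"
  shows "measure_pmf.expectation (rappor_report k \<epsilon> a)
           (\<lambda>y. exp (s * (of_bool (y j) - report_bit_mean (flip_prob \<epsilon>) (a = j))))
         \<le> exp (flip_prob \<epsilon> * (exp l - 1 - l))"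
proof -
  let ?p = "flip_prob \<epsilon>"
  let ?g = "\<lambda>b. exp (s * (of_bool b - report_bit_mean ?p (a = j)))"
  have "measure_pmf.expectation (rappor_report k \<epsilon> a) (\<lambda>y. ?g (y j))
      = measure_pmf.expectation (map_pmf (\<lambda>y. y j) (rappor_report k \<epsilon> a)) ?g"
    by simp
  also have "map_pmf (\<lambda>y. y j) (rappor_report k \<epsilon> a)
      = map_pmf (\<lambda>b. one_hot a j \<noteq> b) (bernoulli_pmf ?p)"
    unfolding rappor_report_def using j by (subst Pi_pmf_component) auto
  \<comment> \<open>If the true bit is 1, the report is the negated flip \<open>b\<close>, and
    centring it at \<open>1 - p\<close> gives \<open>- (of_bool b - p)\<close>. The sign is absorbed
    into \<open>s\<close>.\<close>
  also have "measure_pmf.expectation \<dots> ?g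
      = measure_pmf.expectation (bernoulli_pmf ?p)
          (\<lambda>b. exp ((if a = j then - s else s) * (of_bool b - ?p)))"
    unfolding integral_map_pmf
    by (intro Bochner_Integration.integral_cong refl)
      (auto simp: report_bit_mean_def one_hot_def algebra_simps)
  also have "\<dots> \<le> exp (?p * (exp l - 1 - l))"
    using s flip_prob_bounds by (intro bernoulli_centered_mgf_le) auto
  finally show ?thesis .
qed

text \<open>Users are independent, so the expectation of the exponential of the sum factors into the
  bounds for single reports.\<close>

lemma rappor_reports_mgf_le:
  assumes j: "j \<in> {1..k}" and s: "\<bar>s\<bar> = l"
  shows "measure_pmf.expectation (rappor_reports k n \<epsilon> x)
           (\<lambda>Y. exp (s * (\<Sum>i\<in>{1..n}. of_bool (Y i j) - report_bit_mean (flip_prob \<epsilon>) (x i = j))))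
         \<le> exp (n * (flip_prob \<epsilon> * (exp l - 1 - l)))"
proof -
  let ?f = "\<lambda>i y. exp (s * (of_bool (y j) - report_bit_mean (flip_prob \<epsilon>) (x i = j)))"
  have "measure_pmf.expectation (rappor_reports k n \<epsilon> x)
           (\<lambda>Y. exp (s * (\<Sum>i\<in>{1..n}. of_bool (Y i j) - report_bit_mean (flip_prob \<epsilon>) (x i = j))))
      = measure_pmf.expectation (rappor_reports k n \<epsilon> x) (\<lambda>Y. \<Prod>i\<in>{1..n}. ?f i (Y i))"
    by (simp add: sum_distrib_left exp_sum)
  also have "\<dots> = (\<Prod>i\<in>{1..n}. measure_pmf.expectation (rappor_report k \<epsilon> (x i)) (?f i))"
    unfolding rappor_reports_def
    by (intro expectation_prod_Pi_pmf integrable_measure_pmf_finite finite_set_rappor_report) auto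
  also have "\<dots> \<le> (\<Prod>i\<in>{1..n}. exp (flip_prob \<epsilon> * (exp l - 1 - l)))"
    by (intro prod_mono conjI rappor_report_mgf_le j s integral_nonneg_AE) auto
  also have "\<dots> = exp (n * (flip_prob \<epsilon> * (exp l - 1 - l)))"
    by (simp flip: exp_of_nat_mult)
  finally show ?thesis .
qed

section \<open>The error as a rescaled centred sum\<close>

text \<open>The mean of a reported bit is an affine function of the true bit, and the estimator
  applies the inverse affine map. Hence it is unbiased and only the centred noise remains.\<close>

lemma rappor_error_eq:
  assumes "\<epsilon> > 0" "n > 0"
  shows "rappor_estimate n \<epsilon> Y j - emp_freq n x j
    = (exp (\<epsilon> / 2) + 1) / (exp (\<epsilon> / 2) - 1) / n
        * (\<Sum>i\<in>{1..n}. of_bool (Y i j) - report_bit_mean (flip_prob \<epsilon>) (x i = j))"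
proof -
  define E where "E = exp (\<epsilon> / 2)"
  have E: "E > 1" using assms by (simp add: E_def)
  \<comment> \<open>This is \<open>(E + 1)\<^sup>2\<close> expanded, a denominator to be cleared in
    the next claim.\<close>
  have "1 + (E * E + E * 2) \<noteq> 0" using E mult_pos_pos[of E E] by linarith
  then have c: "report_bit_mean (flip_prob \<epsilon>) (x i = j) = (E - 1) / (E + 1) * of_bool (x i = j) + 1 / (E + 1)" for i
    using E by (auto simp: report_bit_mean_def flip_prob_def E_def[symmetric] field_simps)
  have "(\<Sum>i\<in>{1..n}. of_bool (Y i j) - report_bit_mean (flip_prob \<epsilon>) (x i = j))
     = (\<Sum>i\<in>{1..n}. of_bool (Y i j)) - ((E - 1) / (E + 1) * (\<Sum>i\<in>{1..n}. of_bool (x i = j)) + n / (E + 1))"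
    unfolding c sum_subtractf sum.distrib sum_distrib_left[symmetric] by simp
  moreover have "(E + 1) / (E - 1) * (1 / real n * a) - 1 / (E - 1) - 1 / real n * b
      = (E + 1) / (E - 1) / n * (a - ((E - 1) / (E + 1) * b + n / (E + 1)))" for a b
  proof -
    have "E - 1 \<noteq> 0" "E + 1 \<noteq> 0" "real n \<noteq> 0" using E assms by auto
    then show ?thesis by (simp add: divide_simps)
  qed
  ultimately show ?thesis
    unfolding rappor_estimate_def emp_freq_def report_mean_def E_def[symmetric] by presburger
qed

lemma sup_norm_scale:
  assumes "c \<ge> 0" "k \<ge> 1"
  shows "sup_norm k (\<lambda>j. c * v j) = c * sup_norm k v"
proof -
  have "(\<lambda>j. \<bar>c * v j\<bar>) ` {1..k} = (*) c ` (\<lambda>j. \<bar>v j\<bar>) ` {1..k}"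
    using assms by (simp add: image_image abs_mult)
  moreover have "c * Max ((\<lambda>j. \<bar>v j\<bar>) ` {1..k}) = Max ((*) c ` (\<lambda>j. \<bar>v j\<bar>) ` {1..k})"
    using assms by (intro mono_Max_commute monoI) (auto intro: mult_left_mono)
  ultimately show ?thesis by (simp add: sup_norm_def)
qed

section \<open>Choice of the exponential parameter\<close>

lemma ln_2_ge_half: "ln (2::real) \<ge> 1 / 2"
  using ln_le_minus_one[of "1 / 2 :: real"] by (simp add: ln_div)

lemma poisson_mgf_bound_optimised:
  fixes k n :: nat and \<epsilon> :: real
  assumes k: "k \<ge> 2" and n: "n \<ge> 2" and \<epsilon>: "\<epsilon> \<ge> 1"
  obtains l where "l > 0"
    "(ln (2 * real k) + n * (flip_prob \<epsilon> * (exp l - 1 - l))) / l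
       \<le> n * (32 * (sqrt (ln k / (n * exp (\<epsilon> / 2))) + ln k / (n * \<epsilon>) * ln n))"
proof -
  define L where "L = ln (real k)"
  define N where "N = ln (real n)"
  \<comment> \<open>An upper bound for \<open>n * flip_prob \<epsilon>\<close>, the expected number
    of users whose bit at a given position is flipped.\<close>
  define \<mu> where "\<mu> = n / exp (\<epsilon> / 2)"
  have L: "L \<ge> 1 / 2" using ln_2_ge_half ln_mono[of 2 "real k"] k unfolding L_def by linarith
  have N: "N \<ge> 1 / 2" using ln_2_ge_half ln_mono[of 2 "real n"] n unfolding N_def by linarith
  have \<mu>: "\<mu> > 0" using n by (simp add: \<mu>_def)
  have ln2k: "ln (2 * real k) \<le> 2 * L"
    using k by (simp add: ln_mult L_def)
  have "real n * flip_prob \<epsilon> \<le> n * exp (- \<epsilon> / 2)"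
    using flip_prob_bounds by (intro mult_left_mono) auto
  also have "\<dots> = \<mu>" by (simp add: \<mu>_def exp_minus field_simps)
  finally have np: "real n * flip_prob \<epsilon> \<le> \<mu>" .
  have target: "n * (32 * (sqrt (ln k / (n * exp (\<epsilon> / 2))) + ln k / (n * \<epsilon>) * ln n))
      = 32 * (sqrt (L * \<mu>) + L * N / \<epsilon>)"
  proof -
    have "sqrt (L * \<mu>) = sqrt (real n ^ 2 * (L / (n * exp (\<epsilon> / 2))))"
      using n by (intro arg_cong[where f = sqrt]) (simp add: \<mu>_def power2_eq_square field_simps)
    also have "\<dots> = n * sqrt (L / (n * exp (\<epsilon> / 2)))"
      by (subst real_sqrt_mult) simp
    finally show ?thesis using n by (simp add: L_def N_def algebra_simps)
  qed
  have numer: "ln (2 * real k) + n * (flip_prob \<epsilon> * (exp l - 1 - l)) \<le> 2 * L + \<mu> * (exp l - 1 - l)" for l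
  proof -
    have "0 \<le> exp l - 1 - l" using exp_ge_add_one_self[of l] by linarith
    then have "real n * flip_prob \<epsilon> * (exp l - 1 - l) \<le> \<mu> * (exp l - 1 - l)"
      using np by (intro mult_right_mono)
    then show ?thesis using ln2k by (simp add: mult.assoc)
  qed
  have sq: "sqrt (L * \<mu>) \<ge> 0" using L \<mu> by simp
  have LN: "L * N / \<epsilon> \<ge> 0" using L N \<epsilon> by simp
  have quad: "exp l - 1 - l \<le> l\<^sup>2" if "0 \<le> l" "l \<le> 1" for l :: real
    using exp_bound[OF that] by simp
  have "\<exists>l>0. (2 * L + \<mu> * (exp l - 1 - l)) / l \<le> 32 * (sqrt (L * \<mu>) + L * N / \<epsilon>)"
  proof (cases "\<epsilon> \<le> 4 * N")
    case True
    show ?thesis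
    proof (cases "L \<le> \<mu>")
      case L\<mu>: True
      \<comment> \<open>This choice balances the two terms: \<open>L / l\<close> and
        \<open>\<mu> * l\<close> both equal \<open>sqrt (L * \<mu>)\<close>. Since
        \<open>l \<le> 1\<close>, the quadratic bound applies.\<close>
      define l where "l = sqrt (L / \<mu>)"
      have l: "l > 0" "l \<le> 1" using L \<mu> L\<mu> by (auto simp: l_def)
      have l2: "\<mu> * l\<^sup>2 = L" using L \<mu> by (simp add: l_def)
      have "sqrt (L * \<mu>) * l = sqrt (L * L)"
        unfolding l_def real_sqrt_mult[symmetric] using \<mu> by (intro arg_cong[where f = sqrt]) simp
      then have sql: "sqrt (L * \<mu>) * l = L" using L by simp
      have "2 * L + \<mu> * (exp l - 1 - l) \<le> 2 * L + \<mu> * l\<^sup>2"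
        using quad[of l] l \<mu> by (intro add_left_mono mult_left_mono) auto
      also have "\<dots> = 3 * sqrt (L * \<mu>) * l" using l2 sql by simp
      finally have "(2 * L + \<mu> * (exp l - 1 - l)) / l \<le> 3 * sqrt (L * \<mu>)"
        using l by (simp add: pos_divide_le_eq)
      also have "\<dots> \<le> 32 * (sqrt (L * \<mu>) + L * N / \<epsilon>)" using sq LN by simp
      finally show ?thesis using l by blast
    next
      case False
      \<comment> \<open>With \<open>l = 1\<close> the quotient is at most \<open>3 * L\<close>, and
        \<open>\<epsilon> \<le> 4 * N\<close> lets the second term of the target absorb it.\<close>
      have L4: "L \<le> 4 * (L * N / \<epsilon>)"
        using mult_left_mono[OF True, of L] L \<epsilon> by (simp add: field_simps)
      have "\<mu> * (exp 1 - 1 - 1) \<le> \<mu> * 1"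
        using quad[of 1] \<mu> by (intro mult_left_mono) auto
      then have "(2 * L + \<mu> * (exp 1 - 1 - 1)) / 1 \<le> 3 * L" using False by simp
      also have "\<dots> \<le> 32 * (sqrt (L * \<mu>) + L * N / \<epsilon>)" using L4 sq LN by argo
      finally show ?thesis by (intro exI[of _ 1]) simp
    qed
  next
    case False
    \<comment> \<open>Since \<open>4 * N < \<epsilon>\<close>, the Poisson term is at most
      \<open>exp (N - \<epsilon> / 4) \<le> 1\<close>, and division by \<open>l\<close> produces the
      factor \<open>1 / \<epsilon>\<close>.\<close>
    define l where "l = \<epsilon> / 4"
    have l: "l > 0" using \<epsilon> by (simp add: l_def)
    have "\<mu> * (exp l - 1 - l) \<le> \<mu> * exp l"
      using \<mu> l by (intro mult_left_mono) auto
    also have "\<dots> = exp (N - \<epsilon> / 4)"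
    proof -
      have "\<mu> * exp l = exp N * exp l / exp (\<epsilon> / 2)" using n by (simp add: \<mu>_def N_def)
      also have "\<dots> = exp (N + l - \<epsilon> / 2)" by (simp add: exp_add exp_diff)
      finally show ?thesis by (simp add: l_def)
    qed
    also have "\<dots> \<le> 1" using False by simp
    also have "1 \<le> 2 * L" using L by simp
    finally have "2 * L + \<mu> * (exp l - 1 - l) \<le> 4 * L" by simp
    then have "(2 * L + \<mu> * (exp l - 1 - l)) / l \<le> 4 * L / l"
      using l by (intro divide_right_mono) auto
    also have "\<dots> = 16 * L / \<epsilon>" by (simp add: l_def)
    \<comment> \<open>The missing factor \<open>N\<close> is supplied by
      \<open>N \<ge> 1 / 2\<close>, which doubles 16 to 32; the other cases get by with 3 and
      12.\<close>
    also have "\<dots> \<le> 32 * (L * N) / \<epsilon>"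
      using mult_left_mono[OF N, of L] L \<epsilon> by (intro divide_right_mono) auto
    also have "\<dots> = 32 * (L * N / \<epsilon>)" by simp
    also have "\<dots> \<le> 32 * (sqrt (L * \<mu>) + L * N / \<epsilon>)" using sq by simp
    finally show ?thesis using l by blast
  qed
  then obtain l where l: "l > 0"
      "(2 * L + \<mu> * (exp l - 1 - l)) / l \<le> 32 * (sqrt (L * \<mu>) + L * N / \<epsilon>)"
    by blast
  show ?thesis
  proof (rule that[OF l(1)])
    have "(ln (2 * real k) + n * (flip_prob \<epsilon> * (exp l - 1 - l))) / l
        \<le> (2 * L + \<mu> * (exp l - 1 - l)) / l"
      using l(1) numer[of l] by (intro divide_right_mono) auto
    also note l(2)
    finally show "(ln (2 * real k) + n * (flip_prob \<epsilon> * (exp l - 1 - l))) / l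
        \<le> n * (32 * (sqrt (ln k / (n * exp (\<epsilon> / 2))) + ln k / (n * \<epsilon>) * ln n))"
      unfolding target .
  qed
qed

section \<open>Expected error in the sup norm\<close>

lemma rappor_expected_error_le:
  fixes k n :: nat and \<epsilon> :: real
  assumes k: "k \<ge> 2" and n: "n \<ge> 2" and \<epsilon>: "\<epsilon> \<ge> 1"
  shows "measure_pmf.expectation (rappor_reports k n \<epsilon> x)
          (\<lambda>Y. sup_norm k (\<lambda>j. rappor_estimate n \<epsilon> Y j - emp_freq n x j))
        \<le> 160 * (sqrt (ln k / (n * exp (\<epsilon> / 2))) + ln k / (n * \<epsilon>) * ln n)"
proof -
  define T where "T = sqrt (ln k / (n * exp (\<epsilon> / 2))) + ln k / (n * \<epsilon>) * ln n"
  define c where "c = (exp (\<epsilon> / 2) + 1) / (exp (\<epsilon> / 2) - 1)"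
  define X where "X = (\<lambda>j Y. \<Sum>i\<in>{1..n}. of_bool (Y i j) - report_bit_mean (flip_prob \<epsilon>) (x i = j))"
  let ?M = "rappor_reports k n \<epsilon> x"
  obtain l where l: "l > 0"
    "(ln (2 * real k) + n * (flip_prob \<epsilon> * (exp l - 1 - l))) / l \<le> n * (32 * T)"
    using poisson_mgf_bound_optimised[OF k n \<epsilon>] unfolding T_def by blast
  have "1 + \<epsilon> / 2 \<le> exp (\<epsilon> / 2)" by (rule exp_ge_add_one_self)
  \<comment> \<open>The factor is \<open>1 + 2 / (exp (\<epsilon> / 2) - 1)\<close>, and
    \<open>exp (\<epsilon> / 2) - 1 \<ge> 1 / 2\<close> for \<open>\<epsilon> \<ge> 1\<close>. With
    the 32 of the optimisation this gives \<open>160 = 5 * 32\<close>.\<close>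
  then have c: "0 \<le> c" "c \<le> 5" using \<epsilon> by (auto simp: c_def field_simps)
  have "0 \<le> T" using k n \<epsilon> by (auto simp: T_def intro!: add_nonneg_nonneg)
  have "measure_pmf.expectation ?M (\<lambda>Y. sup_norm k (\<lambda>j. X j Y))
      \<le> ln (2 * real (card {1..k}) * exp (n * (flip_prob \<epsilon> * (exp l - 1 - l)))) / l"
    unfolding sup_norm_def
    by (intro expectation_Max_abs_le finite_set_rappor_reports)
      (use k l rappor_reports_mgf_le in \<open>auto simp: X_def\<close>)
  also have "\<dots> = (ln (2 * real k) + n * (flip_prob \<epsilon> * (exp l - 1 - l))) / l"
    using k by (simp add: ln_mult)
  also note l(2)
  finally have E: "measure_pmf.expectation ?M (\<lambda>Y. sup_norm k (\<lambda>j. X j Y)) \<le> n * (32 * T)" .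
  have "measure_pmf.expectation ?M
          (\<lambda>Y. sup_norm k (\<lambda>j. rappor_estimate n \<epsilon> Y j - emp_freq n x j))
      = measure_pmf.expectation ?M (\<lambda>Y. c / n * sup_norm k (\<lambda>j. X j Y))"
  proof -
    have "rappor_estimate n \<epsilon> Y j - emp_freq n x j = c / n * X j Y" for Y j
      using rappor_error_eq[of \<epsilon> n Y j x] n \<epsilon> by (simp add: X_def c_def)
    moreover have "sup_norm k (\<lambda>j. c / n * X j Y) = c / n * sup_norm k (\<lambda>j. X j Y)" for Y
      using c k by (intro sup_norm_scale) auto
    ultimately show ?thesis by presburger
  qed
  also have "\<dots> = c / n * measure_pmf.expectation ?M (\<lambda>Y. sup_norm k (\<lambda>j. X j Y))"
    by (rule integral_mult_right_zero)
  also have "\<dots> \<le> c / n * (n * (32 * T))"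
    using c by (intro mult_left_mono E) auto
  also have "\<dots> = c * (32 * T)" using n by simp
  also have "\<dots> \<le> 5 * (32 * T)" using c \<open>0 \<le> T\<close> by (intro mult_right_mono) auto
  finally show ?thesis by (simp add: T_def)
qed

theorem theorem7:
  "\<exists>C::real. C > 0 \<and>
     (\<forall>(k::nat) (n::nat) (\<epsilon>::real) (x::nat \<Rightarrow> nat).
        k \<ge> 2 \<longrightarrow> n \<ge> 2 \<longrightarrow> \<epsilon> \<ge> 1 \<longrightarrow> (\<forall>i\<in>{1..n}. x i \<in> {1..k}) \<longrightarrow>
        measure_pmf.expectation (rappor_reports k n \<epsilon> x)
          (\<lambda>Y. sup_norm k (\<lambda>j. rappor_estimate n \<epsilon> Y j - emp_freq n x j))
        \<le> C * (sqrt (ln (real k) / (real n * exp (\<epsilon> / 2)))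
               + ln (real k) / (real n * \<epsilon>) * ln (real n)))"
  using rappor_expected_error_le by (intro exI[of _ 160]) auto

end
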